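(* Let $d(n)$ ($n$ even) be positive integers with $d(n)-\log_2 n\to\infty$ as $n\to\infty$, $n$ even, and let $f_{n,d(n)}$ be uniformly chosen from $\mathrm{Hom}(T_{n,d(n)},0)$. Then, as $n\to\infty$ through even integers, $$\mathbb{P}(\Omega_0\cup\Omega_1)=\mathbb{P}\big(|\mathrm{Rng}(f_{n,d(n)})|\le3\big)\to1\quad\text{and}\quad\mathbb{P}(\Omega_0)=\mathbb{P}(\Omega_1)\to1/2.$$
   Context: For $n\ge1$ even and $d\ge1$, $T_{n,d}$ is the graph with vertex set $\{0,1,\dots,n-1\}$ in which $i,j$ are adjacent iff $\min\{|i-j|,n-|i-j|\}\in\{1,3,\dots,2d+1\}$. $\mathrm{Hom}(T_{n,d},0)$ is the finite set of functions $f\colon\{0,\dots,n-1\}\to\mathbb{Z}$ with $f(0)=0$ and $|f(i)-f(j)|=1$ whenever $i,j$ are adjacent in $T_{n,d}$. $\mathrm{Rng}(f)$ denotes the set of values taken by $f$. $V_0$ and $V_1$ are the sets of even and odd vertices of $T_{n,d}$, respectively; $\Omega_0$ (resp. $\Omega_1$) is the set of homomorphisms in $\mathrm{Hom}(T_{n,d(n)},0)$ that are constant on $V_0$ (resp. on $V_1$). Probabilities of subsets of $\mathrm{Hom}(T_{n,d(n)},0)$ are with respect to the uniform distribution. *)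

theory Defs
  imports "HOL-Probability.Probability"
begin

definition T_verts :: "nat \<Rightarrow> nat set" where
  "T_verts n = {..<n}"

text \<open>Distances are taken in \<open>int\<close> to avoid truncated subtraction.\<close>

definition T_adj :: "nat \<Rightarrow> nat \<Rightarrow> nat \<Rightarrow> nat \<Rightarrow> bool" where
  "T_adj n d i j \<longleftrightarrow> i \<in> T_verts n \<and> j \<in> T_verts n \<and>
     min \<bar>int i - int j\<bar> (int n - \<bar>int i - int j\<bar>) \<in> {2 * int m + 1 | m. m \<le> d}"

text \<open>Membership in \<open>extensional\<close> makes each function on the vertex set be represented by
  exactly one HOL function, so that counting is correct.\<close>

definition Hom_T :: "nat \<Rightarrow> nat \<Rightarrow> (nat \<Rightarrow> int) set" where
  "Hom_T n d = {f \<in> extensional (T_verts n).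
     f 0 = 0 \<and> (\<forall>i j. T_adj n d i j \<longrightarrow> \<bar>f i - f j\<bar> = 1)}"

definition Rng :: "nat \<Rightarrow> (nat \<Rightarrow> int) \<Rightarrow> int set" where
  "Rng n f = f ` T_verts n"

definition V0 :: "nat \<Rightarrow> nat set" where
  "V0 n = {i \<in> T_verts n. even i}"

definition V1 :: "nat \<Rightarrow> nat set" where
  "V1 n = {i \<in> T_verts n. odd i}"

definition Omega0 :: "nat \<Rightarrow> nat \<Rightarrow> (nat \<Rightarrow> int) set" where
  "Omega0 n d = {f \<in> Hom_T n d. f constant_on V0 n}"

definition Omega1 :: "nat \<Rightarrow> nat \<Rightarrow> (nat \<Rightarrow> int) set" where
  "Omega1 n d = {f \<in> Hom_T n d. f constant_on V1 n}"

definition prob_Hom :: "nat \<Rightarrow> nat \<Rightarrow> (nat \<Rightarrow> int) set \<Rightarrow> real" where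
  "prob_Hom n d A = measure_pmf.prob (pmf_of_set (Hom_T n d)) A"

definition even_sequentially :: "nat filter" where
  "even_sequentially = inf sequentially (principal {n. even n})"

text \<open>\<open>pmf_of_set\<close> is only meaningful on finite nonempty sets.\<close>

lemma Hom_T_abs_le:
  assumes f: "f \<in> Hom_T n d" and "i < n"
  shows "\<bar>f i\<bar> \<le> int i"
  using \<open>i < n\<close>
proof (induction i)
  case 0
  then show ?case using f by (simp add: Hom_T_def)
next
  case (Suc i)
  have "min \<bar>int (Suc i) - int i\<bar> (int n - \<bar>int (Suc i) - int i\<bar>) = 2 * int 0 + 1"
    using Suc.prems by simp
  then have "T_adj n d (Suc i) i"
    using Suc.prems unfolding T_adj_def T_verts_def by fastforce
  then have "\<bar>f (Suc i) - f i\<bar> = 1"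
    using f by (simp add: Hom_T_def)
  then show ?case using Suc by simp
qed

lemma finite_Hom_T: "finite (Hom_T n d)"
proof (rule finite_subset)
  show "Hom_T n d \<subseteq> PiE (T_verts n) (\<lambda>_. {- int n..int n})"
  proof
    fix f assume f: "f \<in> Hom_T n d"
    have "f i \<in> {- int n..int n}" if "i < n" for i
      using Hom_T_abs_le[OF f that] that by auto
    moreover have "f \<in> extensional (T_verts n)"
      using f by (simp add: Hom_T_def)
    ultimately show "f \<in> PiE (T_verts n) (\<lambda>_. {- int n..int n})"
      by (simp add: PiE_def T_verts_def)
  qed
qed (simp add: finite_PiE T_verts_def)

lemma T_adj_parity:
  assumes "even n" "T_adj n d i j"
  shows "even i \<longleftrightarrow> odd j"
proof -
  have "odd (min \<bar>int i - int j\<bar> (int n - \<bar>int i - int j\<bar>))"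
    using assms(2) by (auto simp: T_adj_def)
  then have "odd (int i - int j)"
    using assms(1) by (auto simp: min_def split: if_splits)
  then show ?thesis by auto
qed

lemma Hom_T_nonempty:
  assumes "even n" "n > 0"
  shows "Hom_T n d \<noteq> {}"
proof -
  let ?f = "restrict (\<lambda>i. if even i then 0 else 1 :: int) (T_verts n)"
  have "\<bar>?f i - ?f j\<bar> = 1" if "T_adj n d i j" for i j
    using T_adj_parity[OF assms(1) that] that by (auto simp: T_adj_def)
  then have "?f \<in> Hom_T n d"
    using assms(2) by (simp add: Hom_T_def T_verts_def)
  then show ?thesis by blast
qed

end

theory Submission
  imports Defs
begin

text \<open>Record a homomorphism \<open>f\<close> by \<open>f 1\<close> and by its flip set, the positions \<open>k \<ge> 2\<close> with
  \<open>f k \<noteq> f (k - 2)\<close>. Flips of opposite parity are more than \<open>2 * d\<close> apart, and \<open>f\<close> is constant on one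
  of the two vertex classes as soon as all flips have the same parity. Cutting a set with flips of
  both parities at its last parity change gives a recursive inequality, by which there are at most
  \<open>sqrt 2 ^ (n + 3) * ((1 + 2 ^ (-d)) ^ n - 1)\<close> of them. This is negligible against the
  \<open>2 ^ (n div 2)\<close> homomorphisms that vanish on the even vertices when \<open>n * 2 ^ (-d)\<close> tends to 0.
  Rotating the cycle by one step exchanges the two classes.\<close>

section \<open>Sets whose elements of opposite parity are far apart\<close>

text \<open>The constraint that flip sets of homomorphisms turn out to satisfy. The bound
  \<open>m\<close> is kept separate from the cycle length so that the part of a set below a cut
  point is again of this kind.\<close>

definition sep_sets :: "nat \<Rightarrow> nat \<Rightarrow> nat set set" where
  "sep_sets d m = {E. E \<subseteq> {..<m} \<and> (\<forall>i\<in>E. \<forall>j\<in>E. i < j \<and> odd (i + j) \<longrightarrow> i + 2 * d < j)}"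

definition mixed_sets :: "nat \<Rightarrow> nat \<Rightarrow> nat set set" where
  "mixed_sets d m = {E \<in> sep_sets d m. (\<exists>i\<in>E. even i) \<and> (\<exists>i\<in>E. odd i)}"

text \<open>The room left for the elements beyond \<open>x\<close> when \<open>x\<close> is the last
  element before the parity changes for good.\<close>

definition late_sites :: "nat \<Rightarrow> nat \<Rightarrow> nat \<Rightarrow> nat set" where
  "late_sites d m x = {y. x + 2 * d < y \<and> y < m \<and> odd (x + y)}"

lemma finite_sep_sets: "finite (sep_sets d m)"
  by (rule finite_subset[of _ "Pow {..<m}"]) (auto simp: sep_sets_def)

lemma finite_late_sites: "finite (late_sites d m x)"
  by (rule finite_subset[of _ "{..<m}"]) (auto simp: late_sites_def)

lemma card_late_sites: "card (late_sites d m x) \<le> (m - x - 2 * d) div 2"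
proof -
  have "late_sites d m x \<subseteq> (\<lambda>k. x + 2 * d + 1 + 2 * k) ` {..<(m - x - 2 * d) div 2}"
  proof
    fix y assume y: "y \<in> late_sites d m x"
    then have "x + 2 * d + 1 \<le> y" "even (y - (x + 2 * d + 1))"
      by (auto simp: late_sites_def)
    then obtain k where "y = x + 2 * d + 1 + 2 * k"
      by (metis evenE le_add_diff_inverse)
    with y show "y \<in> (\<lambda>k. x + 2 * d + 1 + 2 * k) ` {..<(m - x - 2 * d) div 2}"
      by (auto simp: late_sites_def)
  qed
  from surj_card_le[OF _ this] show ?thesis
    by simp
qed

text \<open>Trading the floor for a power of \<open>sqrt 2\<close> costs at most a factor
  \<open>sqrt 2\<close> and makes the bounds multiplicative in the exponent.\<close>

lemma two_power_div2_le: "(2::real) ^ (k div 2) \<le> sqrt 2 ^ k"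
proof -
  have "(2::real) ^ (k div 2) = sqrt 2 ^ (2 * (k div 2))"
    by (simp add: power_mult)
  also have "\<dots> \<le> sqrt 2 ^ k"
    by (rule power_increasing) auto
  finally show ?thesis .
qed

lemma two_power_le_sqrt_power:
  assumes "c \<le> k div 2"
  shows "(2::real) ^ c \<le> sqrt 2 ^ k"
  by (rule order_trans[OF power_increasing[OF assms] two_power_div2_le]) simp

text \<open>Cut at \<open>x\<close>, the largest element whose parity differs from that of the
  maximum. Below \<open>x\<close> any separated set may occur; above \<open>x\<close> all elements
  share the parity of the maximum, so separation from \<open>x\<close> alone confines them to the
  late sites.\<close>

lemma mixed_sets_subset:
  "mixed_sets d m \<subseteq> (\<Union>x\<in>{x. x + 2 * d < m}.
     (\<lambda>(A, B). insert x (A \<union> B)) ` (sep_sets d x \<times> Pow (late_sites d m x)))"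
proof
  fix E assume "E \<in> mixed_sets d m"
  then have sep: "E \<subseteq> {..<m}" "\<And>i j. i \<in> E \<Longrightarrow> j \<in> E \<Longrightarrow> i < j \<Longrightarrow> odd (i + j) \<Longrightarrow> i + 2 * d < j"
    and mix: "\<exists>i\<in>E. even i" "\<exists>i\<in>E. odd i"
    by (auto simp: mixed_sets_def sep_sets_def)
  have fin: "finite E" using sep(1) finite_subset by blast
  define y where "y = Max E"
  have y: "y \<in> E" "\<And>z. z \<in> E \<Longrightarrow> z \<le> y"
    using fin mix Max_in[of E] Max_ge[of E] unfolding y_def by blast+
  define W where "W = {z\<in>E. odd (z + y)}"
  have "W \<noteq> {}" using mix by (cases "even y") (auto simp: W_def)
  moreover have "finite W" using fin by (auto simp: W_def)
  moreover define x where "x = Max W"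
  ultimately have x: "x \<in> W" "\<And>z. z \<in> W \<Longrightarrow> z \<le> x"
    by auto
  have xy: "x \<in> E" "odd (x + y)" using x(1) by (auto simp: W_def)
  then have "x < y" using y(2)[of x] by (cases "x = y") auto
  then have xm: "x + 2 * d < m" using sep xy y(1) by fastforce
  have "E \<inter> {..<x} \<in> sep_sets d x"
    using sep(2) by (auto simp: sep_sets_def)
  moreover have "E \<inter> {x<..} \<in> Pow (late_sites d m x)"
  proof -
    have "z \<in> late_sites d m x" if z: "z \<in> E" "x < z" for z
    proof -
      have "z \<notin> W" using x(2)[of z] z by auto
      then have "odd (x + z)" using z xy by (auto simp: W_def)
      then show ?thesis using sep z xy by (auto simp: late_sites_def)
    qed
    then show ?thesis by auto
  qed
  ultimately have "(E \<inter> {..<x}, E \<inter> {x<..}) \<in> sep_sets d x \<times> Pow (late_sites d m x)"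
    by (rule SigmaI)
  moreover have "E = (\<lambda>(A, B). insert x (A \<union> B)) (E \<inter> {..<x}, E \<inter> {x<..})"
    using xy by auto
  ultimately have "E \<in> (\<lambda>(A, B). insert x (A \<union> B)) ` (sep_sets d x \<times> Pow (late_sites d m x))"
    by (rule rev_image_eqI)
  with xm show "E \<in> (\<Union>x\<in>{x. x + 2 * d < m}.
     (\<lambda>(A, B). insert x (A \<union> B)) ` (sep_sets d x \<times> Pow (late_sites d m x)))"
    by blast
qed

text \<open>For a fixed cut point \<open>x\<close> the late sites contribute at most
  \<open>sqrt 2 ^ (m - x - 2 * d)\<close> choices. The forbidden gap of length \<open>2 * d\<close>
  is what produces the gain \<open>1 / 2 ^ d\<close>.\<close>

lemma card_mixed_sets_le_sum:
  "real (card (mixed_sets d m)) \<le> sqrt 2 ^ m / 2 ^ d * (\<Sum>x<m. real (card (sep_sets d x)) / sqrt 2 ^ x)"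
proof -
  let ?I = "{x. x + 2 * d < m}"
  let ?S = "\<lambda>x. (\<lambda>(A, B). insert x (A \<union> B)) ` (sep_sets d x \<times> Pow (late_sites d m x))"
  have I: "?I \<subseteq> {..<m}" by auto
  then have fin: "finite ?I" by (rule finite_subset) simp
  have bound: "real (card (?S x)) \<le> sqrt 2 ^ m / 2 ^ d * (real (card (sep_sets d x)) / sqrt 2 ^ x)"
    if x: "x \<in> ?I" for x
  proof -
    have "card (?S x) \<le> card (sep_sets d x \<times> Pow (late_sites d m x))"
      by (intro card_image_le finite_cartesian_product finite_sep_sets) (simp add: finite_late_sites)
    also have "\<dots> = card (sep_sets d x) * 2 ^ card (late_sites d m x)"
      by (simp add: card_cartesian_product card_Pow finite_late_sites)
    finally have "real (card (?S x)) \<le> real (card (sep_sets d x) * 2 ^ card (late_sites d m x))"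
      by (rule of_nat_mono)
    also have "\<dots> = real (card (sep_sets d x)) * 2 ^ card (late_sites d m x)"
      by simp
    also have "\<dots> \<le> real (card (sep_sets d x)) * sqrt 2 ^ (m - x - 2 * d)"
      by (intro mult_left_mono two_power_le_sqrt_power card_late_sites) simp
    also have "sqrt 2 ^ m = sqrt 2 ^ (m - x - 2 * d) * sqrt 2 ^ x * 2 ^ d"
    proof -
      \<comment> \<open>The truncated subtraction is exact because
        \<open>x + 2 * d < m\<close>.\<close>
      have "sqrt 2 ^ m = sqrt 2 ^ ((m - x - 2 * d) + x + 2 * d)"
        using x by simp
      then show ?thesis by (simp only: power_add power_mult) simp
    qed
    then have "real (card (sep_sets d x)) * sqrt 2 ^ (m - x - 2 * d) =
        sqrt 2 ^ m / 2 ^ d * (real (card (sep_sets d x)) / sqrt 2 ^ x)"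
      by simp
    finally show ?thesis .
  qed
  have "card (mixed_sets d m) \<le> card (\<Union>x\<in>?I. ?S x)"
    by (rule card_mono[OF _ mixed_sets_subset])
       (use fin in \<open>auto intro!: finite_imageI finite_cartesian_product finite_sep_sets simp: finite_late_sites\<close>)
  also have "\<dots> \<le> (\<Sum>x\<in>?I. card (?S x))"
    by (rule card_UN_le[OF fin])
  finally have "real (card (mixed_sets d m)) \<le> (\<Sum>x\<in>?I. real (card (?S x)))"
    by (simp only: of_nat_le_iff flip: of_nat_sum)
  also have "\<dots> \<le> (\<Sum>x\<in>?I. sqrt 2 ^ m / 2 ^ d * (real (card (sep_sets d x)) / sqrt 2 ^ x))"
    by (rule sum_mono[OF bound])
  also have "\<dots> \<le> (\<Sum>x<m. sqrt 2 ^ m / 2 ^ d * (real (card (sep_sets d x)) / sqrt 2 ^ x))"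
    by (rule sum_mono2[OF _ I]) auto
  finally show ?thesis by (simp add: sum_distrib_left)
qed

lemma card_parity_class_le:
  "card {i. i < m \<and> even i} \<le> (m + 1) div 2" "card {i. i < m \<and> odd i} \<le> (m + 1) div 2"
proof -
  have "{i. i < m \<and> even i} \<subseteq> (\<lambda>k. 2 * k) ` {..<(m + 1) div 2}"
       "{i. i < m \<and> odd i} \<subseteq> (\<lambda>k. 2 * k + 1) ` {..<(m + 1) div 2}"
    by (auto elim!: evenE oddE)
  then show "card {i. i < m \<and> even i} \<le> (m + 1) div 2" "card {i. i < m \<and> odd i} \<le> (m + 1) div 2"
    using surj_card_le[of "{..<(m + 1) div 2}"] by simp_all
qed

text \<open>A separated set that is not mixed lies inside one parity class, and each class has at
  most \<open>(m + 1) div 2\<close> elements, hence at most \<open>sqrt 2 ^ (m + 1)\<close>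
  subsets.\<close>

lemma card_sep_sets_le_mixed:
  "real (card (sep_sets d m)) \<le> real (card (mixed_sets d m)) + 2 * sqrt 2 * sqrt 2 ^ m"
proof -
  let ?A = "Pow {i. i < m \<and> even i}" and ?B = "Pow {i. i < m \<and> odd i}"
  have fin: "finite {i. i < m \<and> even i}" "finite {i. i < m \<and> odd i}"
    by auto
  have "finite (mixed_sets d m)"
    using finite_sep_sets[of d m] by (simp add: mixed_sets_def)
  moreover have "sep_sets d m \<subseteq> mixed_sets d m \<union> (?A \<union> ?B)"
    by (auto simp: mixed_sets_def sep_sets_def)
  ultimately have "card (sep_sets d m) \<le> card (mixed_sets d m \<union> (?A \<union> ?B))"
    by (intro card_mono) auto
  also have "\<dots> \<le> card (mixed_sets d m) + (card ?A + card ?B)"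
    by (meson add_left_mono card_Un_le le_trans)
  finally have "real (card (sep_sets d m)) \<le> real (card (mixed_sets d m) + (card ?A + card ?B))"
    by (rule of_nat_mono)
  moreover have "real (card ?A) \<le> sqrt 2 ^ (m + 1)" "real (card ?B) \<le> sqrt 2 ^ (m + 1)"
    using card_parity_class_le[of m]
    by (simp_all only: card_Pow fin of_nat_power of_nat_numeral two_power_le_sqrt_power)
  ultimately show ?thesis by simp
qed

section \<open>Solving the recursive inequality for the counts\<close>

lemma sum_power_one_plus: "e * (\<Sum>x<m. (1 + e) ^ x) = (1 + e) ^ m - (1::real)"
  by (induction m) (auto simp: algebra_simps)

text \<open>A discrete Gronwall argument. With \<open>e = 1 / 2 ^ d\<close>, the ratios a(m) on the
  left satisfy a(m) \<le> e * (sum of a(x) over x < m) + \<open>2 * sqrt 2\<close>, and the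
  right-hand side is the solution of the corresponding equation.\<close>

lemma card_sep_sets_le:
  "real (card (sep_sets d m)) / sqrt 2 ^ m \<le> 2 * sqrt 2 * (1 + 1 / 2 ^ d) ^ m"
proof (induction m rule: less_induct)
  case (less m)
  let ?e = "1 / 2 ^ d :: real"
  have s: "sqrt 2 ^ m > (0::real)" by simp
  have "real (card (sep_sets d m)) \<le>
      (?e * (\<Sum>x<m. real (card (sep_sets d x)) / sqrt 2 ^ x) + 2 * sqrt 2) * sqrt 2 ^ m"
    using card_sep_sets_le_mixed[of d m] card_mixed_sets_le_sum[of d m]
    unfolding distrib_right by (simp add: mult_ac)
  then have "real (card (sep_sets d m)) / sqrt 2 ^ m
      \<le> ?e * (\<Sum>x<m. real (card (sep_sets d x)) / sqrt 2 ^ x) + 2 * sqrt 2"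
    by (simp only: pos_divide_le_eq[OF s])
  also have "\<dots> \<le> ?e * (\<Sum>x<m. 2 * sqrt 2 * (1 + ?e) ^ x) + 2 * sqrt 2"
    using less by (intro add_right_mono mult_left_mono sum_mono) auto
  also have "\<dots> = 2 * sqrt 2 * (?e * (\<Sum>x<m. (1 + ?e) ^ x)) + 2 * sqrt 2"
    by (simp only: sum_distrib_left[symmetric] mult.left_commute)
  also have "\<dots> = 2 * sqrt 2 * (1 + ?e) ^ m"
    unfolding sum_power_one_plus by (simp add: algebra_simps)
  finally show ?case .
qed

text \<open>One more application of the recursion, now without the additive term for sets of a
  single parity; its absence leaves the \<open>- 1\<close> that makes the bound small when
  \<open>m / 2 ^ d\<close> is small.\<close>

lemma card_mixed_sets_le:
  "real (card (mixed_sets d m)) \<le> sqrt 2 ^ m * (2 * sqrt 2 * ((1 + 1 / 2 ^ d) ^ m - 1))"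
proof -
  let ?e = "1 / 2 ^ d :: real"
  have "real (card (mixed_sets d m)) \<le> sqrt 2 ^ m * (?e * (\<Sum>x<m. real (card (sep_sets d x)) / sqrt 2 ^ x))"
    using card_mixed_sets_le_sum[of d m] by simp
  also have "\<dots> \<le> sqrt 2 ^ m * (?e * (\<Sum>x<m. 2 * sqrt 2 * (1 + ?e) ^ x))"
    by (intro mult_left_mono sum_mono card_sep_sets_le) auto
  also have "\<dots> = sqrt 2 ^ m * (2 * sqrt 2 * (?e * (\<Sum>x<m. (1 + ?e) ^ x)))"
    by (simp only: sum_distrib_left[symmetric] mult.left_commute)
  finally show ?thesis
    unfolding sum_power_one_plus .
qed

section \<open>Flip sets of homomorphisms\<close>

definition flips :: "nat \<Rightarrow> (nat \<Rightarrow> int) \<Rightarrow> nat set" where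
  "flips n f = {k. 2 \<le> k \<and> k < n \<and> f k \<noteq> f (k - 2)}"

text \<open>The cyclic distance is at most the linear one, and since \<open>n\<close> is even both
  have the same parity.\<close>

lemma T_adj_window:
  assumes "even n" "i < n" "j < n" "odd (i + j)" "i \<le> j + 2 * d + 1" "j \<le> i + 2 * d + 1"
  shows "T_adj n d i j"
proof -
  let ?k = "min \<bar>int i - int j\<bar> (int n - \<bar>int i - int j\<bar>)"
  have "odd ?k" using assms by (auto simp: min_def)
  moreover have "0 \<le> ?k" "?k \<le> 2 * int d + 1" using assms by (auto simp: min_def)
  moreover obtain b where b: "?k = 2 * b + 1" using \<open>odd ?k\<close> by (rule oddE)
  ultimately have "?k = 2 * int (nat b) + 1" "nat b \<le> d"
    by linarith+
  then show ?thesis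
    using assms(2,3) unfolding T_adj_def T_verts_def by blast
qed

lemma Hom_T_diff:
  assumes "f \<in> Hom_T n d" "even n" "i < n" "j < n" "odd (i + j)" "i \<le> j + 2 * d + 1" "j \<le> i + 2 * d + 1"
  shows "\<bar>f i - f j\<bar> = 1"
  using T_adj_window[OF assms(2-7)] assms(1) by (auto simp: Hom_T_def)

text \<open>If \<open>i\<close> and \<open>j\<close> were too close, then \<open>i - 2\<close> and
  \<open>i\<close> would both be adjacent to \<open>j - 2\<close> and \<open>j\<close>. Distinct
  values at \<open>i - 2\<close> and \<open>i\<close> leave only their midpoint as value at
  \<open>j - 2\<close> and at \<open>j\<close>, so \<open>j\<close> would not be a flip.\<close>

lemma flips_sep_sets:
  assumes f: "f \<in> Hom_T n d" and n: "even n"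
  shows "flips n f \<in> sep_sets d n"
proof -
  have False if ij: "i \<in> flips n f" "j \<in> flips n f" "i < j" "odd (i + j)" "j \<le> i + 2 * d" for i j
  proof -
    have b: "2 \<le> i" "i < n" "2 \<le> j" "j < n" "f i \<noteq> f (i - 2)" "f j \<noteq> f (j - 2)"
      using ij by (auto simp: flips_def)
    \<comment> \<open>Parity gains one: \<open>j - i\<close> is odd, so it cannot equal
      \<open>2 * d\<close>. This puts the widest pair, \<open>i - 2\<close> and \<open>j\<close>, at
      distance at most \<open>2 * d + 1\<close>.\<close>
    have le: "j + 1 \<le> i + 2 * d" using ij by presburger
    obtain i' j' where ij': "i = i' + 2" "j = j' + 2"
      using b(1,3) by (metis add.commute le_Suc_ex)
    have "\<bar>f i - f j\<bar> = 1" "\<bar>f i' - f j\<bar> = 1" "\<bar>f i - f j'\<bar> = 1" "\<bar>f i' - f j'\<bar> = 1"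
      by (rule Hom_T_diff[OF f n]; use b(2,4) ij(3,4) le in \<open>simp add: ij'\<close>)+
    moreover have "f i \<noteq> f i'" "f j \<noteq> f j'" using b(5,6) by (simp_all add: ij')
    ultimately show False by linarith
  qed
  then show ?thesis
    by (fastforce simp: sep_sets_def flips_def not_less[symmetric])
qed

lemma Hom_T_step:
  assumes "f \<in> Hom_T n d" "even n" "Suc i < n"
  shows "\<bar>f (Suc i) - f i\<bar> = 1"
  by (rule Hom_T_diff[OF assms(1,2)]) (use assms in auto)

lemma Hom_T_even_iff:
  assumes "f \<in> Hom_T n d" "even n" "i < n"
  shows "even (f i) \<longleftrightarrow> even i"
  using assms(3)
proof (induction i)
  case 0
  then show ?case using assms(1) by (simp add: Hom_T_def)
next
  case (Suc i)
  have "f (Suc i) = f i + 1 \<or> f (Suc i) = f i - 1"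
    using Hom_T_step[OF assms(1,2) Suc.prems] by linarith
  then show ?case using Suc by auto
qed

text \<open>Given \<open>f k\<close> and \<open>f (k + 1)\<close>, the two candidates for
  \<open>f (k + 2)\<close> are \<open>f (k + 1) + 1\<close> and \<open>f (k + 1) - 1\<close>; one of
  them is \<open>f k\<close>, and the flip set tells which is taken.\<close>

lemma Hom_T_eqI:
  assumes f: "f \<in> Hom_T n d" and g: "g \<in> Hom_T n d" and n: "even n"
    and one: "f 1 = g 1" and flip: "flips n f = flips n g"
  shows "f = g"
proof (rule extensionalityI[of _ "T_verts n"])
  show "f \<in> extensional (T_verts n)" "g \<in> extensional (T_verts n)"
    using f g by (auto simp: Hom_T_def)
  have "f i = g i" if "i < n" for i
    using that
  proof (induction i rule: less_induct)
    case (less i)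
    consider "i = 0" | "i = 1" | k where "i = Suc (Suc k)"
      by (metis One_nat_def not0_implies_Suc)
    then show ?case
    proof cases
      case 1
      then show ?thesis using f g by (simp add: Hom_T_def)
    next
      case 2
      then show ?thesis using one by simp
    next
      case 3
      have "f k = g k" "f (Suc k) = g (Suc k)" using less 3 by auto
      moreover have "\<bar>f (Suc k) - f k\<bar> = 1" "\<bar>f i - f (Suc k)\<bar> = 1" "\<bar>g i - g (Suc k)\<bar> = 1"
        using Hom_T_step[OF f n] Hom_T_step[OF g n] less.prems 3 by auto
      moreover have "i \<in> flips n f \<longleftrightarrow> i \<in> flips n g"
        using flip by simp
      then have "f i = f k \<longleftrightarrow> g i = g k"
        using less.prems unfolding 3 by (simp add: flips_def)
      ultimately show ?thesis by linarith
    qed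
  qed
  then show "\<And>i. i \<in> T_verts n \<Longrightarrow> f i = g i"
    by (simp add: T_verts_def)
qed

lemma Hom_T_one:
  assumes "f \<in> Hom_T n d" "even n" "n > 0"
  shows "f 1 \<in> {-1, 1}"
proof -
  have "f 0 = 0" using assms(1) by (simp add: Hom_T_def)
  moreover have "Suc 0 < n" using assms by presburger
  ultimately show ?thesis using Hom_T_step[OF assms(1,2), of 0] by auto
qed

text \<open>The number \<open>p\<close> names the class, 0 for the even and 1 for the odd vertices.
  Without flips in it, the value at \<open>p\<close> propagates in steps of two.\<close>

lemma constant_on_parity_class:
  assumes "\<And>k. k \<in> flips n f \<Longrightarrow> odd (k + p)" and "p < 2"
  shows "f constant_on {i. i < n \<and> even (i + p)}"
proof -
  have "f (p + 2 * k) = f p" if "p + 2 * k < n" for k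
    using that
  proof (induction k)
    case (Suc k)
    have "p + 2 * Suc k \<notin> flips n f" using assms(1)[of "p + 2 * Suc k"] by auto
    then show ?case using Suc by (auto simp: flips_def)
  qed simp
  moreover have "\<exists>k. i = p + 2 * k" if "even (i + p)" for i
    using that assms(2) by presburger
  ultimately show ?thesis
    unfolding constant_on_def by (metis (mono_tags, lifting) mem_Collect_eq)
qed

lemma flips_mixed_sets:
  assumes f: "f \<in> Hom_T n d" and n: "even n" and "f \<notin> Omega0 n d \<union> Omega1 n d"
  shows "flips n f \<in> mixed_sets d n"
proof -
  have V: "{i. i < n \<and> even (i + 0)} = V0 n" "{i. i < n \<and> even (i + 1)} = V1 n"
    by (auto simp: V0_def V1_def T_verts_def)
  have "\<not> f constant_on V0 n" "\<not> f constant_on V1 n"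
    using assms by (auto simp: Omega0_def Omega1_def)
  then have "\<exists>k\<in>flips n f. even k" "\<exists>k\<in>flips n f. odd k"
    using constant_on_parity_class[of n f 0] constant_on_parity_class[of n f 1] unfolding V by auto
  then show ?thesis
    using flips_sep_sets[OF f n] by (simp add: mixed_sets_def)
qed

text \<open>The pair of \<open>f 1\<close> and the flip set determines \<open>f\<close>; the factor
  2 counts the values of \<open>f 1\<close>.\<close>

lemma card_nonconstant_le:
  assumes n: "even n" "n > 0"
  shows "card (Hom_T n d - (Omega0 n d \<union> Omega1 n d)) \<le> 2 * card (mixed_sets d n)"
proof -
  let ?B = "Hom_T n d - (Omega0 n d \<union> Omega1 n d)"
  have "finite (mixed_sets d n)"
    using finite_sep_sets[of d n] by (simp add: mixed_sets_def)
  moreover have "inj_on (\<lambda>f. (f 1, flips n f)) ?B"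
    by (rule inj_onI) (use Hom_T_eqI n in auto)
  moreover have "(\<lambda>f. (f 1, flips n f)) ` ?B \<subseteq> {-1, 1} \<times> mixed_sets d n"
    using Hom_T_one[OF _ n] flips_mixed_sets[OF _ n(1)] by blast
  ultimately have "card ?B \<le> card ({-1, 1 :: int} \<times> mixed_sets d n)"
    by (intro card_inj_on_le) auto
  then show ?thesis by (simp add: card_cartesian_product)
qed

section \<open>The two constant classes\<close>

text \<open>If \<open>f\<close> is constant on one class, every other vertex has a neighbour in that
  class, so all values lie within 1 of the constant. Conversely, values are even on
  \<open>V0\<close> and odd on \<open>V1\<close>, so two distinct values on each class would give
  four in total.\<close>

lemma Omega_Un_eq:
  assumes n: "even n" "n > 0"
  shows "Omega0 n d \<union> Omega1 n d = {f \<in> Hom_T n d. card (Rng n f) \<le> 3}"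
proof (intro equalityI subsetI)
  fix f assume "f \<in> Omega0 n d \<union> Omega1 n d"
  then have f: "f \<in> Hom_T n d" and "f constant_on V0 n \<or> f constant_on V1 n"
    by (auto simp: Omega0_def Omega1_def)
  then obtain c p where c: "\<And>i. i < n \<Longrightarrow> even (i + p) \<Longrightarrow> f i = c" and p: "p < (2::nat)"
    unfolding constant_on_def V0_def V1_def T_verts_def
    by (elim disjE exE) (force intro: that[of 0], force intro: that[of 1])
  have "f i \<in> {c - 1, c, c + 1}" if i: "i < n" for i
  proof (cases "even (i + p)")
    case True
    then show ?thesis using c i by simp
  next
    case False
    \<comment> \<open>The partner of \<open>i\<close> in the pairing of \<open>2 * k\<close> with
      \<open>2 * k + 1\<close>; it stays below \<open>n\<close> because \<open>n\<close> is
      even.\<close>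
    define j where "j = (if even i then Suc i else i - 1)"
    have j: "j < n" "odd (i + j)" "i \<le> j + 1" "j \<le> i + 1"
      using i n(1) by (auto simp: j_def) presburger
    then have "f j = c" using c False by auto
    moreover have "\<bar>f i - f j\<bar> = 1"
      by (rule Hom_T_diff[OF f n(1)]) (use i j in auto)
    ultimately show ?thesis by auto
  qed
  then have "Rng n f \<subseteq> {c - 1, c, c + 1}"
    by (auto simp: Rng_def T_verts_def)
  from card_mono[OF _ this] f show "f \<in> {f \<in> Hom_T n d. card (Rng n f) \<le> 3}"
    by auto
next
  fix f assume "f \<in> {f \<in> Hom_T n d. card (Rng n f) \<le> 3}"
  then have f: "f \<in> Hom_T n d" and card: "card (Rng n f) \<le> 3" by auto
  have const: "\<exists>a\<in>V. \<exists>b\<in>V. f a \<noteq> f b" if "\<not> f constant_on V" for V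
    using that unfolding constant_on_def by metis
  show "f \<in> Omega0 n d \<union> Omega1 n d"
  proof (rule ccontr)
    assume "f \<notin> Omega0 n d \<union> Omega1 n d"
    then have "\<not> f constant_on V0 n" "\<not> f constant_on V1 n"
      using f by (auto simp: Omega0_def Omega1_def)
    then obtain a b a' b' where ab: "a \<in> V0 n" "b \<in> V0 n" "f a \<noteq> f b"
        "a' \<in> V1 n" "b' \<in> V1 n" "f a' \<noteq> f b'"
      using const by meson
    then have "{f a, f b, f a', f b'} \<subseteq> Rng n f"
      by (auto simp: Rng_def V0_def V1_def)
    moreover have "finite (Rng n f)" by (simp add: Rng_def T_verts_def)
    moreover have "even (f a)" "even (f b)" "odd (f a')" "odd (f b')"
      using ab Hom_T_even_iff[OF f n(1)] by (auto simp: V0_def V1_def T_verts_def)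
    then have "f a \<noteq> f a'" "f a \<noteq> f b'" "f b \<noteq> f a'" "f b \<noteq> f b'"
      by metis+
    with ab have "card {f a, f b, f a', f b'} = 4" by simp
    ultimately have "4 \<le> card (Rng n f)"
      by (metis card_mono)
    with card show False by simp
  qed
qed

lemma card_Omega0_ge:
  assumes n: "even n" "n > 0"
  shows "2 ^ (n div 2) \<le> card (Omega0 n d)"
proof -
  \<comment> \<open>Zero on the even vertices, with a free choice of sign at each of the
    \<open>n div 2\<close> odd ones; \<open>X\<close> records the positive signs.\<close>
  let ?g = "\<lambda>X. restrict (\<lambda>i. if even i then 0 else if i div 2 \<in> X then 1 else -1 :: int) (T_verts n)"
  have "inj_on ?g (Pow {..<n div 2})"
  proof (rule inj_onI)
    fix X Y assume X: "X \<in> Pow {..<n div 2}" "Y \<in> Pow {..<n div 2}" and eq: "?g X = ?g Y"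
    have "k \<in> X \<longleftrightarrow> k \<in> Y" if "k < n div 2" for k
      using fun_cong[OF eq, of "2 * k + 1"] that n by (auto simp: T_verts_def split: if_splits)
    then show "X = Y" using X by blast
  qed
  moreover have "?g X \<in> Omega0 n d" for X
  proof -
    have "\<bar>?g X i - ?g X j\<bar> = 1" if "T_adj n d i j" for i j
      using T_adj_parity[OF n(1) that] that by (auto simp: T_adj_def)
    moreover have "?g X constant_on V0 n"
      by (auto simp: constant_on_def V0_def)
    ultimately show ?thesis using n(2) by (simp add: Omega0_def Hom_T_def T_verts_def)
  qed
  moreover have "finite (Omega0 n d)"
    using finite_Hom_T[of n d] by (simp add: Omega0_def)
  ultimately have "card (Pow {..<n div 2}) \<le> card (Omega0 n d)"
    by (intro card_inj_on_le[of ?g]) auto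
  then show ?thesis by (simp add: card_Pow)
qed

text \<open>Being constant on both classes rules out every flip, so only the value
  \<open>f 1\<close> remains free.\<close>

lemma card_Omega_Int_le:
  assumes n: "even n" "n > 0"
  shows "card (Omega0 n d \<inter> Omega1 n d) \<le> 2"
proof -
  have "flips n f = {}" if "f \<in> Omega0 n d \<inter> Omega1 n d" for f
  proof -
    have "f k = f (k - 2)" if "2 \<le> k" "k < n" for k
    proof (cases "even k")
      case True
      then have "k \<in> V0 n" "k - 2 \<in> V0 n" using that by (auto simp: V0_def T_verts_def)
      then show ?thesis using \<open>f \<in> _\<close> by (auto simp: Omega0_def constant_on_def)
    next
      case False
      then have "k \<in> V1 n" "k - 2 \<in> V1 n" using that by (auto simp: V1_def T_verts_def)
      then show ?thesis using \<open>f \<in> _\<close> by (auto simp: Omega1_def constant_on_def)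
    qed
    then show ?thesis by (auto simp: flips_def)
  qed
  then have "inj_on (\<lambda>f. f 1) (Omega0 n d \<inter> Omega1 n d)"
    by (intro inj_onI Hom_T_eqI[OF _ _ n(1)]) (auto simp: Omega0_def)
  moreover have "(\<lambda>f. f 1) ` (Omega0 n d \<inter> Omega1 n d) \<subseteq> {-1, 1}"
    using Hom_T_one[OF _ n] by (auto simp: Omega0_def)
  ultimately have "card (Omega0 n d \<inter> Omega1 n d) \<le> card {-1, 1 :: int}"
    by (intro card_inj_on_le) auto
  then show ?thesis by simp
qed

text \<open>The pullback along the rotation of the cycle by one step; subtracting \<open>f 1\<close>
  restores the value 0 at vertex 0.\<close>

definition rotate_hom :: "nat \<Rightarrow> (nat \<Rightarrow> int) \<Rightarrow> nat \<Rightarrow> int" where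
  "rotate_hom n f = restrict (\<lambda>i. f (Suc i mod n) - f 1) (T_verts n)"

lemma Suc_mod_eq: "i < n \<Longrightarrow> Suc i mod n = (if Suc i = n then 0 else Suc i)"
  by auto

lemma T_adj_rotate:
  assumes "T_adj n d i j"
  shows "T_adj n d (Suc i mod n) (Suc j mod n)"
proof -
  have ij: "i < n" "j < n" using assms by (auto simp: T_adj_def T_verts_def)
  have "min \<bar>int (Suc i mod n) - int (Suc j mod n)\<bar> (int n - \<bar>int (Suc i mod n) - int (Suc j mod n)\<bar>)
      = min \<bar>int i - int j\<bar> (int n - \<bar>int i - int j\<bar>)"
    \<comment> \<open>If exactly one of the two vertices wraps around to 0, the two arguments of
      \<open>min\<close> change places; otherwise the difference is unchanged.\<close>
    unfolding Suc_mod_eq[OF ij(1)] Suc_mod_eq[OF ij(2)] using ij by auto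
  then show ?thesis using assms ij by (simp add: T_adj_def T_verts_def)
qed

lemma rotate_hom_Hom_T:
  assumes "f \<in> Hom_T n d" "even n" "n > 0"
  shows "rotate_hom n f \<in> Hom_T n d"
proof -
  have "Suc 0 < n" using assms by presburger
  then have "rotate_hom n f 0 = 0" by (simp add: rotate_hom_def T_verts_def)
  moreover have "\<bar>rotate_hom n f i - rotate_hom n f j\<bar> = 1" if "T_adj n d i j" for i j
  proof -
    have "i \<in> T_verts n" "j \<in> T_verts n" using that by (auto simp: T_adj_def)
    moreover have "\<bar>f (Suc i mod n) - f (Suc j mod n)\<bar> = 1"
      using T_adj_rotate[OF that] assms(1) by (simp add: Hom_T_def)
    ultimately show ?thesis by (simp add: rotate_hom_def)
  qed
  ultimately show ?thesis by (simp add: Hom_T_def rotate_hom_def)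
qed

lemma inj_on_rotate_hom:
  assumes "n > 0"
  shows "inj_on (rotate_hom n) (Hom_T n d)"
proof (rule inj_onI)
  fix f g assume f: "f \<in> Hom_T n d" and g: "g \<in> Hom_T n d" and eq: "rotate_hom n f = rotate_hom n g"
  have shift: "f (Suc i mod n) - f 1 = g (Suc i mod n) - g 1" if "i < n" for i
    using fun_cong[OF eq, of i] that by (simp add: rotate_hom_def T_verts_def)
  have zero: "f 0 = 0" "g 0 = 0" using f g by (auto simp: Hom_T_def)
  \<comment> \<open>At vertex \<open>n - 1\<close> the rotated function equals
    \<open>f 0 - f 1 = - f 1\<close>, which reveals the subtracted constant.\<close>
  then have one: "f 1 = g 1" using shift[of "n - 1"] assms by simp
  show "f = g"
  proof (rule extensionalityI[of _ "T_verts n"])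
    show "f \<in> extensional (T_verts n)" "g \<in> extensional (T_verts n)"
      using f g by (auto simp: Hom_T_def)
    fix i assume "i \<in> T_verts n"
    then show "f i = g i"
      using zero one shift[of "i - 1"] by (cases i) (auto simp: T_verts_def)
  qed
qed

text \<open>The rotation swaps even and odd vertices, so it injects each class of homomorphisms into
  the other; finiteness gives both inequalities.\<close>

lemma card_Omega_eq:
  assumes n: "even n" "n > 0"
  shows "card (Omega0 n d) = card (Omega1 n d)"
proof (rule antisym)
  have fin: "finite (Omega0 n d)" "finite (Omega1 n d)"
    using finite_Hom_T[of n d] by (auto simp: Omega0_def Omega1_def)
  have inj: "inj_on (rotate_hom n) (Omega0 n d)" "inj_on (rotate_hom n) (Omega1 n d)"
    by (rule inj_on_subset[OF inj_on_rotate_hom[OF n(2)]]; auto simp: Omega0_def Omega1_def)+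
  have mod: "Suc i mod n < n" "even (Suc i mod n) \<longleftrightarrow> odd i" for i
    using n by (auto simp: even_mod_2_iff dvd_mod_iff)
  have const: "rotate_hom n f constant_on V"
    if f: "f constant_on W" and V: "V \<subseteq> T_verts n" "\<And>i. i \<in> V \<Longrightarrow> Suc i mod n \<in> W" for f V W
    using f V unfolding constant_on_def rotate_hom_def by (auto simp: subset_iff)
  have "rotate_hom n ` Omega0 n d \<subseteq> Omega1 n d"
    using rotate_hom_Hom_T[OF _ n] const[of _ "V0 n" "V1 n"] mod
    by (force simp: Omega0_def Omega1_def V0_def V1_def T_verts_def)
  then show "card (Omega0 n d) \<le> card (Omega1 n d)"
    using card_inj_on_le inj fin by blast
  have "rotate_hom n ` Omega1 n d \<subseteq> Omega0 n d"
    using rotate_hom_Hom_T[OF _ n] const[of _ "V1 n" "V0 n"] mod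
    by (force simp: Omega0_def Omega1_def V0_def V1_def T_verts_def)
  then show "card (Omega1 n d) \<le> card (Omega0 n d)"
    using card_inj_on_le inj fin by blast
qed

section \<open>Probabilities\<close>

lemma prob_Hom_eq:
  assumes "even n" "n > 0" "A \<subseteq> Hom_T n d"
  shows "prob_Hom n d A = real (card A) / real (card (Hom_T n d))"
  using assms by (simp add: prob_Hom_def measure_pmf_of_set Hom_T_nonempty finite_Hom_T Int_absorb1)

lemma Omega_subset: "Omega0 n d \<subseteq> Hom_T n d" "Omega1 n d \<subseteq> Hom_T n d"
  by (auto simp: Omega0_def Omega1_def)

lemma card_Hom_T_ge:
  assumes n: "even n" "n > 0"
  shows "sqrt 2 ^ n \<le> real (card (Hom_T n d))"
proof -
  have "sqrt 2 ^ n = sqrt 2 ^ (2 * (n div 2))" using n by simp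
  also have "\<dots> = real (2 ^ (n div 2))" by (simp add: power_mult)
  also have "2 ^ (n div 2) \<le> card (Hom_T n d)"
    using card_Omega0_ge[OF n] card_mono[OF finite_Hom_T Omega_subset(1)] by (rule le_trans)
  finally show ?thesis by simp
qed

text \<open>The exceptional homomorphisms number at most twice the mixed sets, and
  \<open>(1 + 1 / 2 ^ d) ^ n\<close> is at most \<open>exp (n / 2 ^ d)\<close>. The factor
  \<open>sqrt 2 ^ n\<close> in that count is absorbed by the lower bound on the number of all
  homomorphisms.\<close>

lemma prob_Omega_Un_ge:
  assumes n: "even n" "n > 0"
  shows "1 - 4 * sqrt 2 * (exp (real n / 2 ^ d) - 1) \<le> prob_Hom n d (Omega0 n d \<union> Omega1 n d)"
proof -
  let ?H = "Hom_T n d" and ?U = "Omega0 n d \<union> Omega1 n d"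
  let ?b = "4 * sqrt 2 * (exp (real n / 2 ^ d) - 1)"
  have pos: "real (card ?H) > 0"
    using card_Hom_T_ge[OF n] by (smt (verit) real_sqrt_gt_zero zero_less_power)
  have "(1 + 1 / 2 ^ d :: real) ^ n \<le> exp (1 / 2 ^ d) ^ n"
    by (intro power_mono exp_ge_add_one_self) simp
  also have "\<dots> = exp (real n / 2 ^ d)"
    by (simp add: exp_of_nat_mult[symmetric])
  finally have e: "(1 + 1 / 2 ^ d :: real) ^ n \<le> exp (real n / 2 ^ d)" .
  have "real (card (?H - ?U)) \<le> 2 * real (card (mixed_sets d n))"
    using card_nonconstant_le[OF n, of d] by linarith
  also have "\<dots> \<le> 2 * (sqrt 2 ^ n * (2 * sqrt 2 * ((1 + 1 / 2 ^ d) ^ n - 1)))"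
    by (intro mult_left_mono card_mixed_sets_le) simp
  also have "\<dots> = sqrt 2 ^ n * (4 * sqrt 2 * ((1 + 1 / 2 ^ d) ^ n - 1))"
    by simp
  also have "\<dots> \<le> sqrt 2 ^ n * ?b"
    using e by (intro mult_left_mono) auto
  also have "\<dots> \<le> real (card ?H) * ?b"
    using card_Hom_T_ge[OF n] by (intro mult_right_mono) auto
  finally have "real (card (?H - ?U)) \<le> real (card ?H) * ?b" .
  moreover have "real (card ?H) = real (card ?U) + real (card (?H - ?U))"
    using card_Diff_subset[of ?U ?H] card_mono[of ?H ?U] Omega_subset[of n d] finite_Hom_T[of n d]
    by (simp add: finite_subset)
  ultimately have "(1 - ?b) * real (card ?H) \<le> real (card ?U)"
    by (simp add: algebra_simps)
  moreover have "prob_Hom n d ?U = real (card ?U) / real (card ?H)"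
    by (rule prob_Hom_eq[OF n]) (use Omega_subset in auto)
  ultimately show ?thesis
    using pos by (simp add: pos_le_divide_eq)
qed

lemma prob_Omega_eq:
  assumes n: "even n" "n > 0"
  shows "prob_Hom n d (Omega0 n d) = prob_Hom n d (Omega1 n d)"
  by (simp add: prob_Hom_eq[OF n] Omega_subset card_Omega_eq[OF n])

text \<open>Inclusion-exclusion with two equally likely events gives \<open>u\<close> as twice the
  probability of one minus that of the intersection, and the intersection has at most two
  elements.\<close>

lemma prob_Omega1_bounds:
  fixes d :: nat
  assumes n: "even n" "n > 0"
  defines "u \<equiv> prob_Hom n d (Omega0 n d \<union> Omega1 n d)"
  shows "u / 2 \<le> prob_Hom n d (Omega1 n d)" "prob_Hom n d (Omega1 n d) \<le> u / 2 + (1 / sqrt 2) ^ n"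
proof -
  let ?I = "Omega0 n d \<inter> Omega1 n d"
  have "u = prob_Hom n d (Omega0 n d) + prob_Hom n d (Omega1 n d) - prob_Hom n d ?I"
    unfolding u_def prob_Hom_def by (rule measure_Un3) (auto simp: measure_pmf.fmeasurable_eq_sets)
  then have u: "u = 2 * prob_Hom n d (Omega1 n d) - prob_Hom n d ?I"
    by (simp add: prob_Omega_eq[OF n])
  have "0 \<le> prob_Hom n d ?I" by (simp add: prob_Hom_def)
  with u show "u / 2 \<le> prob_Hom n d (Omega1 n d)" by simp
  have "prob_Hom n d ?I = real (card ?I) / real (card (Hom_T n d))"
    by (rule prob_Hom_eq[OF n]) (use Omega_subset in auto)
  also have "\<dots> \<le> 2 / sqrt 2 ^ n"
    using card_Omega_Int_le[OF n, of d] card_Hom_T_ge[OF n, of d] by (intro frac_le) auto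
  also have "\<dots> = 2 * (1 / sqrt 2) ^ n"
    by (simp add: power_one_over)
  finally show "prob_Hom n d (Omega1 n d) \<le> u / 2 + (1 / sqrt 2) ^ n"
    using u by linarith
qed

lemma eventually_even_sequentially:
  assumes "\<And>n. even n \<Longrightarrow> n > 0 \<Longrightarrow> P n"
  shows "eventually P even_sequentially"
  unfolding even_sequentially_def eventually_inf_principal
  using eventually_gt_at_top[of 0] by eventually_elim (use assms in auto)

theorem corollary2p7:
  fixes d :: "nat \<Rightarrow> nat"
  assumes d_pos: "\<And>n. even n \<Longrightarrow> n > 0 \<Longrightarrow> d n \<ge> 1"
    and d_large: "filterlim (\<lambda>n. real (d n) - log 2 (real n)) at_top even_sequentially"
  shows "(\<forall>n. even n \<and> n > 0 \<longrightarrow>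
            prob_Hom n (d n) (Omega0 n (d n) \<union> Omega1 n (d n)) =
            prob_Hom n (d n) {f \<in> Hom_T n (d n). card (Rng n f) \<le> 3})
       \<and> ((\<lambda>n. prob_Hom n (d n) {f \<in> Hom_T n (d n). card (Rng n f) \<le> 3})
            \<longlongrightarrow> 1) even_sequentially
       \<and> (\<forall>n. even n \<and> n > 0 \<longrightarrow>
            prob_Hom n (d n) (Omega0 n (d n)) = prob_Hom n (d n) (Omega1 n (d n)))
       \<and> ((\<lambda>n. prob_Hom n (d n) (Omega1 n (d n))) \<longlongrightarrow> 1 / 2) even_sequentially"
proof -
  let ?F = even_sequentially
  let ?U = "\<lambda>n. prob_Hom n (d n) (Omega0 n (d n) \<union> Omega1 n (d n))"
  let ?O = "\<lambda>n. prob_Hom n (d n) (Omega1 n (d n))"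
  \<comment> \<open>Chosen so that \<open>exp (- ?g n)\<close> is exactly
    \<open>n / 2 ^ d n\<close>, which turns the growth hypothesis into convergence of this quotient
    to 0.\<close>
  let ?g = "\<lambda>n. ln 2 * (real (d n) - log 2 (real n))"
  have "filterlim ?g at_top ?F"
    by (rule filterlim_tendsto_pos_mult_at_top[OF tendsto_const _ d_large]) simp
  then have "filterlim (\<lambda>n. - ?g n) at_bot ?F"
    by (simp only: filterlim_uminus_at_bot minus_minus)
  then have "((\<lambda>n. exp (- ?g n)) \<longlongrightarrow> 0) ?F"
    by (rule filterlim_compose[OF exp_at_bot])
  moreover have "\<forall>\<^sub>F n in ?F. exp (- ?g n) = real n / 2 ^ d n"
  proof (rule eventually_even_sequentially)
    fix n :: nat assume "n > 0"
    then have "- ?g n = ln (real n) - real (d n) * ln 2"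
      by (simp add: log_def algebra_simps)
    then show "exp (- ?g n) = real n / 2 ^ d n"
      using \<open>n > 0\<close> by (simp add: exp_diff exp_of_nat_mult)
  qed
  ultimately have "((\<lambda>n. real n / 2 ^ d n) \<longlongrightarrow> 0) ?F"
    by (rule Lim_transform_eventually)
  then have "((\<lambda>n. 1 - 4 * sqrt 2 * (exp (real n / 2 ^ d n) - 1)) \<longlongrightarrow> 1 - 4 * sqrt 2 * (exp 0 - 1)) ?F"
    by (intro tendsto_intros)
  then have lower: "((\<lambda>n. 1 - 4 * sqrt 2 * (exp (real n / 2 ^ d n) - 1)) \<longlongrightarrow> 1) ?F"
    by simp
  have lim_U: "(?U \<longlongrightarrow> 1) ?F"
  proof (rule tendsto_sandwich[OF _ _ lower tendsto_const])
    show "\<forall>\<^sub>F n in ?F. 1 - 4 * sqrt 2 * (exp (real n / 2 ^ d n) - 1) \<le> ?U n"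
      by (intro eventually_even_sequentially prob_Omega_Un_ge)
    show "\<forall>\<^sub>F n in ?F. ?U n \<le> 1"
      by (simp add: prob_Hom_def)
  qed
  have "(\<lambda>n. (1 / sqrt 2) ^ n) \<longlonglongrightarrow> 0"
    by (rule LIMSEQ_power_zero) simp
  then have small: "((\<lambda>n. (1 / sqrt 2) ^ n) \<longlongrightarrow> 0) ?F"
    unfolding even_sequentially_def by (rule tendsto_mono[OF inf_le1])
  have half: "((\<lambda>n. ?U n / 2) \<longlongrightarrow> 1 / 2) ?F"
    using lim_U by (intro tendsto_intros) auto
  \<comment> \<open>Both bounds on the probability of \<open>Omega1\<close> converge to 1/2, since
    the union has probability tending to 1 and the overlap term vanishes.\<close>
  have "(?O \<longlongrightarrow> 1 / 2) ?F"
  proof (rule tendsto_sandwich[OF _ _ half])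
    show "((\<lambda>n. ?U n / 2 + (1 / sqrt 2) ^ n) \<longlongrightarrow> 1 / 2) ?F"
      using tendsto_add[OF half small] by simp
    show "\<forall>\<^sub>F n in ?F. ?U n / 2 \<le> ?O n"
      by (intro eventually_even_sequentially prob_Omega1_bounds)
    show "\<forall>\<^sub>F n in ?F. ?O n \<le> ?U n / 2 + (1 / sqrt 2) ^ n"
      by (intro eventually_even_sequentially prob_Omega1_bounds)
  qed
  moreover have "((\<lambda>n. prob_Hom n (d n) {f \<in> Hom_T n (d n). card (Rng n f) \<le> 3}) \<longlongrightarrow> 1) ?F"
    by (rule Lim_transform_eventually[OF lim_U])
       (rule eventually_even_sequentially, simp add: Omega_Un_eq)
  ultimately show ?thesis
    using Omega_Un_eq prob_Omega_eq by simp
qed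

end
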